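(* Let $N$ be an integer greater than $1$, and let $C_N=(P_1)-(P_N)$ on $X_0(N)$. Then $$\mathsf{GCD}(C_N)=\mathfrak{g}(N)\quad\text{and}\quad\mathfrak{h}(C_N)=\mathfrak{h}(N),$$ where $\mathfrak{g}$ and $\mathfrak{h}$ are defined as follows: 1. $\mathfrak{g}(1)=0$; 2. $\mathfrak{g}(N)=\gcd(N+(-1)^{t-1},\ p_i^2-1:1\le i\le t)$ if $N=\prod_{i=1}^tp_i$ is squarefree; 3. $\mathfrak{g}(N)=\gcd(p,\mathfrak{g}(M))$ if $N=Mp^2$ with $p$ prime, $\gcd(M,p)=1$ and $M$ squarefree; 4. $\mathfrak{g}(N)=1$ otherwise. Also, $\mathfrak{h}(N)=2$ if one of the following holds, and $\mathfrak{h}(N)=1$ otherwise: 1. $N=p$ for a prime $p$; 2. $N=2^r$ for an odd integer $r$; 3. $N=pq$ for two distinct odd primes $p$ and $q$ such that $\mathrm{val}_2(p-1)=\mathrm{val}_2(q-1)$ and $\mathrm{val}_2(p+1)=\mathrm{val}_2(q+1)$; 4. $N=4p$ for a prime $p$ congruent to $1$ modulo $4$.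
   Context: For $d\mid N$, a cusp of $X_0(N)$ is of level $d$ if it is represented by $x/d$ with $\gcd(x,d)=1$; $(P_d)$ is the sum of all cusps of level $d$, each with multiplicity one (so $(P_1)$ is the cusp $0$ and $(P_N)$ is the cusp $\infty$). For a prime $p$ and $r\ge1$, with $m(j)=\min(j,r-j)$, let $\Upsilon(p^r)$ be the matrix indexed by divisors of $p^r$ with $\Upsilon(p^r)_{p^ip^j}=p$ if $i=j\in\{0,r\}$; $p^{m(j)-1}(p^2+1)$ if $1\le i=j\le r-1$; $-p^{m(j)}$ if $|i-j|=1$; $0$ if $|i-j|\ge2$. For $N=\prod p_i^{r_i}$, $\delta=\prod p_i^{e_i}$, $d=\prod p_i^{f_i}$, put $\Upsilon(N)_{\delta d}=\prod_i\Upsilon(p_i^{r_i})_{p_i^{e_i}p_i^{f_i}}$. For nonzero $C=\sum_{d\mid N} a_d(P_d)$ ($a_d\in\mathbf{Z}$): $V(C)_\delta=\sum_{d\mid N}\Upsilon(N)_{\delta d}\,a_d$; $\mathsf{GCD}(C)$ is the greatest common divisor of the entries $V(C)_\delta$, $\delta\mid N$; $\mathbb{V}(C)=\mathsf{GCD}(C)^{-1}V(C)$; for a prime $p$, $\mathsf{Pw}_p(C)=\sum_{\delta\mid N,\ \mathrm{val}_p(\delta)\ \text{odd}}\mathbb{V}(C)_\delta$; $\mathfrak{h}(C)=1$ if $\mathsf{Pw}_p(C)$ is even for all primes $p$, and $\mathfrak{h}(C)=2$ otherwise. *)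

theory Defs
  imports "HOL-Analysis.Determinants" "HOL-Computational_Algebra.Computational_Algebra"
begin

section \<open>Cusps of $X_0(N)$ and their levels\<close>

definition Gamma0 :: "nat \<Rightarrow> (int ^ 2 ^ 2) set" where
  "Gamma0 N = {A. det A = 1 \<and> int N dvd A $ 2 $ 1}"

text \<open>The projective line over the rationals is rendered as \<open>rat option\<close>, with \<open>None\<close> for the
  point at infinity; integer matrices act on it by fractional linear transformations.\<close>

fun moebius :: "int ^ 2 ^ 2 \<Rightarrow> rat option \<Rightarrow> rat option" where
  "moebius A None =
     (if A $ 2 $ 1 = 0 then None else Some (of_int (A $ 1 $ 1) / of_int (A $ 2 $ 1)))"
| "moebius A (Some q) =
     (if of_int (A $ 2 $ 1) * q + of_int (A $ 2 $ 2) = 0 then None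
      else Some ((of_int (A $ 1 $ 1) * q + of_int (A $ 1 $ 2)) /
                 (of_int (A $ 2 $ 1) * q + of_int (A $ 2 $ 2))))"

type_synonym cusp = "rat option set"

definition cusp_of :: "nat \<Rightarrow> rat option \<Rightarrow> cusp" where
  "cusp_of N s = (\<lambda>A. moebius A s) ` Gamma0 N"

definition cusps :: "nat \<Rightarrow> cusp set" where
  "cusps N = range (cusp_of N)"

definition cusps_of_level :: "nat \<Rightarrow> nat \<Rightarrow> cusp set" where
  "cusps_of_level N d =
     {c \<in> cusps N. \<exists>x::int. gcd x (int d) = 1 \<and> Some (of_int x / of_nat d) \<in> c}"

text \<open>A cuspidal divisor is given by its multiplicity at each cusp (there are only finitely many
  cusps).\<close>

type_synonym cusp_divisor = "cusp \<Rightarrow> int"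

definition P :: "nat \<Rightarrow> nat \<Rightarrow> cusp_divisor" where
  "P N d = (\<lambda>c. if c \<in> cusps_of_level N d then 1 else 0)"

definition sum_divisor :: "nat \<Rightarrow> (nat \<Rightarrow> int) \<Rightarrow> cusp_divisor" where
  "sum_divisor N a = (\<lambda>c. \<Sum>d | d dvd N. a d * P N d c)"

text \<open>The integers $a_d$ in $C = \sum_{d \mid N} a_d (P_d)$. They are unique; see
  \<open>level_coeffs_sum_divisor\<close> below.\<close>

definition level_coeffs :: "nat \<Rightarrow> cusp_divisor \<Rightarrow> nat \<Rightarrow> int" where
  "level_coeffs N C = (THE a. (\<forall>d. \<not> d dvd N \<longrightarrow> a d = 0) \<and> C = sum_divisor N a)"

definition C_div :: "nat \<Rightarrow> cusp_divisor" where
  "C_div N = (\<lambda>c. P N 1 c - P N N c)"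


section \<open>The invariants of a divisor\<close>

text \<open>\<open>Upsilon_pp p r i j\<close> is the entry of $\Upsilon(p^r)$ at $(p^i, p^j)$.\<close>

definition Upsilon_pp :: "nat \<Rightarrow> nat \<Rightarrow> nat \<Rightarrow> nat \<Rightarrow> int" where
  "Upsilon_pp p r i j =
     (let m = min j (r - j) in
      if i = j then
        (if i = 0 \<or> i = r then int p else int p ^ (m - 1) * (int p ^ 2 + 1))
      else if i = j + 1 \<or> j = i + 1 then - (int p ^ m)
      else 0)"

definition Upsilon :: "nat \<Rightarrow> nat \<Rightarrow> nat \<Rightarrow> int" where
  "Upsilon N \<delta> d =
     (\<Prod>p\<in>prime_factors N.
        Upsilon_pp p (multiplicity p N) (multiplicity p \<delta>) (multiplicity p d))"

definition V :: "nat \<Rightarrow> cusp_divisor \<Rightarrow> nat \<Rightarrow> int" where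
  "V N C \<delta> = (\<Sum>d | d dvd N. Upsilon N \<delta> d * level_coeffs N C d)"

definition GCD_div :: "nat \<Rightarrow> cusp_divisor \<Rightarrow> int" where
  "GCD_div N C = Gcd (V N C ` {\<delta>. \<delta> dvd N})"

text \<open>The division is exact.\<close>

definition VV :: "nat \<Rightarrow> cusp_divisor \<Rightarrow> nat \<Rightarrow> int" where
  "VV N C \<delta> = V N C \<delta> div GCD_div N C"

definition Pw :: "nat \<Rightarrow> nat \<Rightarrow> cusp_divisor \<Rightarrow> int" where
  "Pw N p C = (\<Sum>\<delta> | \<delta> dvd N \<and> odd (multiplicity p \<delta>). VV N C \<delta>)"

definition h_div :: "nat \<Rightarrow> cusp_divisor \<Rightarrow> nat" where
  "h_div N C = (if \<forall>p. prime p \<longrightarrow> even (Pw N p C) then 1 else 2)"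


section \<open>The arithmetic functions $\mathfrak{g}$ and $\mathfrak{h}$\<close>

definition g_squarefree :: "nat \<Rightarrow> int" where
  "g_squarefree N =
     (if N = 1 then 0
      else Gcd (insert (int N + (-1) ^ (card (prime_factors N) - 1))
                  ((\<lambda>p. int p ^ 2 - 1) ` prime_factors N)))"

definition sqfree_times_sq :: "nat \<Rightarrow> nat \<Rightarrow> nat \<Rightarrow> bool" where
  "sqfree_times_sq N M p \<longleftrightarrow>
     N = M * p ^ 2 \<and> prime p \<and> coprime M p \<and> squarefree M"

text \<open>The pair $(M, p)$ is determined by $N$, so that the value below is the one required; see
  \<open>g_num_sqfree_times_sq\<close>.\<close>

definition g_num :: "nat \<Rightarrow> int" where
  "g_num N =
     (if squarefree N then g_squarefree N
      else if \<exists>M p. sqfree_times_sq N M p then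
        (THE g. \<exists>M p. sqfree_times_sq N M p \<and> g = gcd (int p) (g_squarefree M))
      else 1)"

definition h_num :: "nat \<Rightarrow> nat" where
  "h_num N =
     (if prime N \<or>
         (\<exists>r. odd r \<and> N = 2 ^ r) \<or>
         (\<exists>p q. prime p \<and> prime q \<and> odd p \<and> odd q \<and> p \<noteq> q \<and> N = p * q \<and>
            multiplicity 2 (p - 1) = multiplicity 2 (q - 1) \<and>
            multiplicity 2 (p + 1) = multiplicity 2 (q + 1)) \<or>
         (\<exists>p. prime p \<and> p mod 4 = 1 \<and> N = 4 * p)
      then 2 else 1)"


section \<open>Well-definedness\<close>

lemma sqfree_times_sq_unique:
  assumes "sqfree_times_sq N M p" "sqfree_times_sq N M' p'"
  shows "M = M'" "p = p'"
proof -
  have pp: "prime p" "prime p'" "coprime M p" "squarefree M'"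
    and N: "N = M * p ^ 2" "N = M' * p' ^ 2" "squarefree M"
    using assms by (auto simp: sqfree_times_sq_def)
  show "p = p'"
  proof (rule ccontr)
    assume ne: "p \<noteq> p'"
    then have "coprime (p ^ 2) (p' ^ 2)"
      using pp by (simp add: primes_coprime)
    moreover have "p ^ 2 dvd M' * p' ^ 2" using N by (metis dvd_triv_right)
    ultimately have "p ^ 2 dvd M'" by (simp add: coprime_dvd_mult_left_iff)
    then have "p dvd 1" using pp(4) squarefreeD by blast
    then show False using pp by simp
  qed
  then show "M = M'" using N pp by auto
qed

lemma g_num_1: "g_num 1 = 0"
  by (simp add: g_num_def g_squarefree_def)

lemma g_num_squarefree:
  "N > 1 \<Longrightarrow> squarefree N \<Longrightarrow>
     g_num N = Gcd (insert (int N + (-1) ^ (card (prime_factors N) - 1))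
                      ((\<lambda>p. int p ^ 2 - 1) ` prime_factors N))"
  by (simp add: g_num_def g_squarefree_def)

lemma g_num_sqfree_times_sq:
  assumes "N = M * p ^ 2" "prime p" "coprime M p" "squarefree M"
  shows "g_num N = gcd (int p) (g_num M)"
proof -
  have *: "sqfree_times_sq N M p" using assms by (simp add: sqfree_times_sq_def)
  have "\<not> squarefree N"
    using assms by (metis dvd_triv_right not_prime_unit squarefreeD)
  moreover have
    "(THE g. \<exists>M p. sqfree_times_sq N M p \<and> g = gcd (int p) (g_squarefree M))
       = gcd (int p) (g_squarefree M)"
    using * by (intro the_equality) (auto dest: sqfree_times_sq_unique)
  ultimately show ?thesis using * assms(4) by (auto simp: g_num_def)
qed

lemma g_num_other:
  "\<not> squarefree N \<Longrightarrow>
     \<not> (\<exists>M p. N = M * p ^ 2 \<and> prime p \<and> coprime M p \<and> squarefree M) \<Longrightarrow> g_num N = 1"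
  by (auto simp: g_num_def sqfree_times_sq_def)

fun point_level :: "nat \<Rightarrow> rat option \<Rightarrow> int" where
  "point_level N None = int N"
| "point_level N (Some q) = gcd (snd (quotient_of q)) (int N)"

lemma point_level_frac:
  assumes "coprime a b" "b \<noteq> 0"
  shows "point_level N (Some (of_int a / of_int b)) = gcd b (int N)"
proof -
  have "quotient_of (of_int a / of_int b) = Rat.normalize (a, b)"
    by (metis Fract_of_int_quotient quotient_of_Fract)
  then show ?thesis
    using assms by (auto simp: Rat.normalize_def Let_def)
qed

lemma point_level_moebius:
  assumes "A \<in> Gamma0 N"
  shows "point_level N (moebius A s) = point_level N s"
proof -
  define a b c e where abce: "a = A $ 1 $ 1" "b = A $ 1 $ 2" "c = A $ 2 $ 1" "e = A $ 2 $ 2"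
  have det: "a * e - b * c = 1" and Nc: "int N dvd c"
    using assms by (auto simp: Gamma0_def det_2 abce)
  have eN: "coprime e (int N)"
  proof (rule coprimeI)
    fix k assume "k dvd e" "k dvd int N"
    then have "k dvd a * e - b * c" using Nc by (meson dvd_diff dvd_mult dvd_trans)
    then show "is_unit k" using det by simp
  qed
  show ?thesis
  proof (cases s)
    case None
    have "coprime a c"
    proof (rule coprimeI)
      fix k assume "k dvd a" "k dvd c"
      then have "k dvd a * e - b * c" by simp
      then show "is_unit k" using det by simp
    qed
    then show ?thesis
      using None Nc point_level_frac[of a c N]
      by (auto simp: abce[symmetric] gcd_proj2_if_dvd)
  next
    case (Some q)
    obtain x y where xy: "quotient_of q = (x, y)" by fastforce
    have y: "y > 0" and cop: "coprime x y" and q: "q = of_int x / of_int y"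
      using quotient_of_denom_pos[OF xy] quotient_of_coprime[OF xy] quotient_of_div[OF xy]
      by auto
    have lev: "gcd (c * x + e * y) (int N) = gcd y (int N)"
    proof -
      obtain k where k: "c = int N * k" using Nc by blast
      have "gcd (c * x + e * y) (int N) = gcd (e * y) (int N)"
        using gcd_add_mult[of "int N" "k * x" "e * y"]
        by (simp add: k gcd.commute mult_ac)
      also have "\<dots> = gcd y (int N)" using eN
        by (metis coprime_commute gcd.commute gcd_mult_left_left_cancel)
      finally show ?thesis .
    qed
    have den: "of_int c * q + of_int e = (of_int (c * x + e * y) :: rat) / of_int y"
     and num: "of_int a * q + of_int b = (of_int (a * x + b * y) :: rat) / of_int y"
      using y by (auto simp: q field_simps)
    show ?thesis
    proof (cases "c * x + e * y = 0")
      case True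
      then show ?thesis
        using lev den Some xy by (simp add: abce[symmetric])
    next
      case False
      have "coprime (a * x + b * y) (c * x + e * y)"
      proof (rule coprimeI)
        fix k assume k: "k dvd a * x + b * y" "k dvd c * x + e * y"
        have "k dvd e * (a * x + b * y) - b * (c * x + e * y)"
          and "k dvd a * (c * x + e * y) - c * (a * x + b * y)"
          using k by (auto intro: dvd_diff dvd_mult)
        moreover have "e * (a * x + b * y) - b * (c * x + e * y) = (a * e - b * c) * x"
          and "a * (c * x + e * y) - c * (a * x + b * y) = (a * e - b * c) * y"
          by (auto simp: algebra_simps)
        ultimately have "k dvd x" "k dvd y" using det by auto
        then show "is_unit k" using cop by (meson coprime_def)
      qed
      moreover have "moebius A s = Some (of_int (a * x + b * y) / of_int (c * x + e * y))"
      proof -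
        have "of_int (c * x + e * y) \<noteq> (0 :: rat)"
          using False of_int_eq_0_iff by blast
        then have "of_int c * q + of_int e \<noteq> 0" using y
          by (simp only: den divide_eq_0_iff of_int_eq_0_iff) simp
        then show ?thesis
          using y by (simp only: Some moebius.simps abce[symmetric] den num) simp
      qed
      ultimately have "point_level N (moebius A s) = gcd (c * x + e * y) (int N)"
        by (simp only: point_level_frac[OF _ False])
      then show ?thesis
        by (simp only: lev) (simp add: Some xy)
    qed
  qed
qed

lemma cusps_of_level_disjoint:
  assumes "d dvd N" "d' dvd N" "N > 0" "c \<in> cusps_of_level N d" "c \<in> cusps_of_level N d'"
  shows "d = d'"
proof -
  obtain s where s: "c = cusp_of N s"
    using assms(4) by (auto simp: cusps_of_level_def cusps_def)
  have "int d = point_level N s" if dN: "d dvd N" and cd: "c \<in> cusps_of_level N d" for d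
  proof -
    have "\<exists>x::int. gcd x (int d) = 1 \<and> Some (of_int x / of_nat d) \<in> c"
      using cd by (simp add: cusps_of_level_def)
    then obtain x :: int where x: "gcd x (int d) = 1" "Some (of_int x / of_nat d) \<in> c"
      by (elim exE conjE)
    have "point_level N (Some (of_int x / of_nat d)) = point_level N s"
      using x(2) s point_level_moebius unfolding cusp_of_def by (metis imageE)
    moreover have "point_level N (Some (of_int x / of_nat d)) = int d"
      using point_level_frac[of x "int d" N] x(1) dN assms(3)
      by (auto simp: coprime_iff_gcd_eq_1 gcd_proj1_if_dvd)
    ultimately show ?thesis by simp
  qed
  from this[of d] this[of d'] show ?thesis using assms by simp
qed

lemma cusps_of_level_nonempty: "cusp_of N (Some (1 / of_nat d)) \<in> cusps_of_level N d"
proof -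
  have "mat 1 \<in> Gamma0 N" by (simp add: Gamma0_def det_I) (simp add: mat_def)
  moreover have "moebius (mat 1) (Some q) = Some q" for q by (simp add: mat_def)
  ultimately have "Some (1 / of_nat d) \<in> cusp_of N (Some (1 / of_nat d))"
    unfolding cusp_of_def by (metis image_eqI)
  then show ?thesis
    unfolding cusps_of_level_def cusps_def by (auto intro!: exI[of _ 1])
qed

lemma level_coeffs_sum_divisor:
  assumes "N > 0" "\<And>d. \<not> d dvd N \<Longrightarrow> a d = 0"
  shows "level_coeffs N (sum_divisor N a) = a"
proof -
  have fin: "finite {d. d dvd N}" using assms(1) by simp
  have eval: "sum_divisor N a (cusp_of N (Some (1 / of_nat d))) = a d" if d: "d dvd N" for a d
  proof -
    let ?c = "cusp_of N (Some (1 / of_nat d))"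
    have "P N d' ?c = (if d' = d then 1 else 0)" if "d' dvd N" for d'
      using cusps_of_level_disjoint[OF that d assms(1)] cusps_of_level_nonempty[of N d]
      by (auto simp: P_def)
    then have "sum_divisor N a ?c = (\<Sum>d' | d' dvd N. if d' = d then a d' else 0)"
      unfolding sum_divisor_def by (intro sum.cong) auto
    also have "\<dots> = a d" using fin d by simp
    finally show ?thesis .
  qed
  show ?thesis
    unfolding level_coeffs_def
  proof (rule the_equality)
    fix b assume b: "(\<forall>d. \<not> d dvd N \<longrightarrow> b d = 0) \<and> sum_divisor N a = sum_divisor N b"
    show "b = a"
      by (rule ext) (metis b eval assms(2))
  qed (use assms in auto)
qed

end

theory Submission
  imports Defs "HOL-Number_Theory.Cong"
begin

text \<open>
  Write \<open>e\<^sub>p\<close>, \<open>r\<^sub>p\<close> for the exponents of \<open>p\<close> in \<open>\<delta>\<close>, \<open>N\<close>. The first column of \<open>\<Upsilon>(p\<^sup>r)\<close> is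
  \<open>\<alpha>\<^sub>p = (p, - 1, 0, \<dots>, 0)\<close> and the last one is its reversal, so \<open>V(C\<^sub>N)\<^sub>\<delta>\<close> is
  \<open>\<Prod>\<^sub>p \<alpha>\<^sub>p(e\<^sub>p) - \<Prod>\<^sub>p \<alpha>\<^sub>p(r\<^sub>p - e\<^sub>p)\<close>. The greatest common divisor is read off this formula by testing
  well-chosen \<open>\<delta>\<close>. Summing over the \<open>\<delta>\<close> with \<open>e\<^sub>l\<close> odd makes the products factor: the sum is
  \<open>- (l + 1) \<Prod>\<^sub>q\<^sub>\<noteq>\<^sub>l (q - 1)\<close> if \<open>r\<^sub>l\<close> is odd, and \<open>0\<close> otherwise. Hence \<open>h = 2\<close> exactly when, for some
  such \<open>l\<close>, this product has the same 2-adic valuation as \<open>g(N)\<close>, which is decided case by case.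
\<close>

section \<open>Divisors and exponent vectors\<close>

lemma multiplicity_prod_prime_factors:
  fixes N :: nat
  assumes "prime p"
  shows "multiplicity p (\<Prod>q\<in>prime_factors N. q ^ f q) = (if p \<in> prime_factors N then f p else 0)"
  using assms by (intro multiplicity_prod_prime_powers) auto

lemma prod_prime_factors_dvd:
  fixes N :: nat
  assumes "N > 0" "\<And>p. p \<in> prime_factors N \<Longrightarrow> f p \<le> multiplicity p N"
  shows "(\<Prod>q\<in>prime_factors N. q ^ f q) dvd N"
  using assms by (intro multiplicity_le_imp_dvd) (auto simp: multiplicity_prod_prime_factors)

lemma prod_prime_factors_divisor:
  fixes N d :: nat
  assumes "N > 0" "d dvd N"
  shows "(\<Prod>q\<in>prime_factors N. q ^ multiplicity q d) = d"
proof (rule multiplicity_eq_nat)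
  show "d > 0" using assms by (auto intro: Nat.gr0I)
  show "0 < (\<Prod>q\<in>prime_factors N. q ^ multiplicity q d)"
    by (auto intro!: prod_pos prime_gt_0_nat dest: in_prime_factors_imp_prime)
  fix p :: nat assume p: "prime p"
  have "multiplicity p d = 0" if "p \<notin> prime_factors N"
    using that p assms by (metis dvd_trans in_prime_factors_iff not_dvd_imp_multiplicity_0 gr_implies_not0)
  then show "multiplicity p (\<Prod>q\<in>prime_factors N. q ^ multiplicity q d) = multiplicity p d"
    using p by (auto simp: multiplicity_prod_prime_factors)
qed

lemma obtain_divisor_multiplicity:
  fixes N :: nat
  assumes "N > 0" "\<And>p. p \<in> prime_factors N \<Longrightarrow> f p \<le> multiplicity p N"
  obtains d where "d dvd N" "\<And>p. p \<in> prime_factors N \<Longrightarrow> multiplicity p d = f p"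
  using assms prod_prime_factors_dvd[of N f] multiplicity_prod_prime_factors[of _ f N]
  by (metis in_prime_factors_imp_prime)

text \<open>By unique factorization a divisor of \<open>N\<close> is a choice of one exponent per
  prime factor, so this is distributivity over \<open>PiE\<close>; \<open>restrict\<close> makes the
  exponent function extensional.\<close>

lemma sum_divisors_prod:
  fixes f :: "nat \<Rightarrow> nat \<Rightarrow> int" and N :: nat
  assumes "N > 0"
  shows "(\<Sum>d | d dvd N. \<Prod>p\<in>prime_factors N. f p (multiplicity p d)) =
         (\<Prod>p\<in>prime_factors N. \<Sum>e\<le>multiplicity p N. f p e)"
proof -
  let ?A = "prime_factors N" and ?B = "\<lambda>p. {..multiplicity p N}"
  have "(\<Sum>d | d dvd N. \<Prod>p\<in>?A. f p (multiplicity p d)) = (\<Sum>g\<in>PiE ?A ?B. \<Prod>p\<in>?A. f p (g p))"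
  proof (rule sum.reindex_bij_witness
      [of _ "\<lambda>g. \<Prod>p\<in>?A. p ^ g p" "\<lambda>d. restrict (\<lambda>p. multiplicity p d) ?A"])
    fix d assume "d \<in> {d. d dvd N}"
    then show "(\<Prod>p\<in>?A. p ^ restrict (\<lambda>p. multiplicity p d) ?A p) = d"
      using prod_prime_factors_divisor[OF assms, of d] by simp
    show "restrict (\<lambda>p. multiplicity p d) ?A \<in> PiE ?A ?B"
      using \<open>d \<in> {d. d dvd N}\<close> assms by (auto intro: dvd_imp_multiplicity_le)
    show "(\<Prod>p\<in>?A. f p (restrict (\<lambda>p. multiplicity p d) ?A p)) = (\<Prod>p\<in>?A. f p (multiplicity p d))"
      by simp
  next
    fix g assume g: "g \<in> PiE ?A ?B"
    show "restrict (\<lambda>p. multiplicity p (\<Prod>p\<in>?A. p ^ g p)) ?A = g"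
      using g by (auto simp: fun_eq_iff restrict_def PiE_def extensional_def
          multiplicity_prod_prime_factors[OF in_prime_factors_imp_prime])
    show "(\<Prod>p\<in>?A. p ^ g p) \<in> {d. d dvd N}"
      using g assms prod_prime_factors_dvd[of N g] by (auto simp: PiE_iff)
  qed
  also have "\<dots> = (\<Prod>p\<in>?A. \<Sum>e\<in>?B p. f p e)"
    by (rule prod_sum_PiE[symmetric]) auto
  finally show ?thesis .
qed

section \<open>The vector of the divisor\<close>

text \<open>\<open>r\<close> is no parameter: for different \<open>r > 0\<close> these columns
  differ only in the number of trailing zeros.\<close>

definition first_col :: "nat \<Rightarrow> nat \<Rightarrow> int" where
  "first_col p e = (if e = 0 then int p else if e = 1 then - 1 else 0)"

definition cusp_vec :: "nat \<Rightarrow> nat \<Rightarrow> int" where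
  "cusp_vec N \<delta> = (\<Prod>p\<in>prime_factors N. first_col p (multiplicity p \<delta>)) -
                  (\<Prod>p\<in>prime_factors N. first_col p (multiplicity p N - multiplicity p \<delta>))"

lemma first_col_simps [simp]:
  "first_col p 0 = int p" "first_col p (Suc 0) = - 1" "first_col p (Suc (Suc k)) = 0"
  by (auto simp: first_col_def)

lemma Upsilon_pp_first: "r > 0 \<Longrightarrow> Upsilon_pp p r e 0 = first_col p e"
  by (auto simp: Upsilon_pp_def first_col_def)

text \<open>By the symmetry of the matrix under \<open>(i, j) \<mapsto> (r - i, r - j)\<close>, its last column is the first one
  reversed.\<close>

lemma Upsilon_pp_last: "r > 0 \<Longrightarrow> e \<le> r \<Longrightarrow> Upsilon_pp p r e r = first_col p (r - e)"
  by (auto simp: Upsilon_pp_def first_col_def)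

text \<open>\<open>C_div N\<close> is written as \<open>sum_divisor\<close> of a family supported on
  the divisors of \<open>N\<close>; uniqueness in \<open>level_coeffs_sum_divisor\<close> then
  evaluates the definite description.\<close>

lemma level_coeffs_C_div:
  assumes "N > 1"
  shows "level_coeffs N (C_div N) = (\<lambda>d. of_bool (d = 1) - of_bool (d = N))"
proof -
  have fin: "finite {d. d dvd N}" using assms by simp
  have delta: "(\<Sum>d | d dvd N. of_bool (d = k) * f d) = f k" if "k dvd N" for k and f :: "nat \<Rightarrow> int"
  proof -
    have "(\<Sum>d | d dvd N. of_bool (d = k) * f d) = (\<Sum>d | d dvd N. if d = k then f d else 0)"
      by (intro sum.cong) auto
    then show ?thesis using fin that by simp
  qed
  have "C_div N = sum_divisor N (\<lambda>d. of_bool (d = 1) - of_bool (d = N))"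
    using delta[of 1] delta[of N]
    by (simp add: fun_eq_iff C_div_def sum_divisor_def left_diff_distrib sum_subtractf del: of_bool_eq_iff)
  moreover have "level_coeffs N (sum_divisor N (\<lambda>d. of_bool (d = 1) - of_bool (d = N))) =
      (\<lambda>d. of_bool (d = 1) - of_bool (d = N))"
    by (rule level_coeffs_sum_divisor) (use assms in auto)
  ultimately show ?thesis by simp
qed

lemma V_C_div:
  assumes "N > 1" "\<delta> dvd N"
  shows "V N (C_div N) \<delta> = cusp_vec N \<delta>"
proof -
  have fin: "finite {d. d dvd N}" using assms by simp
  have delta: "(\<Sum>d | d dvd N. f d * of_bool (d = k)) = f k" if "k dvd N" for k and f :: "nat \<Rightarrow> int"
  proof -
    have "(\<Sum>d | d dvd N. f d * of_bool (d = k)) = (\<Sum>d | d dvd N. if d = k then f d else 0)"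
      by (intro sum.cong) auto
    then show ?thesis using fin that by simp
  qed
  have pos: "multiplicity p N > 0" "multiplicity p \<delta> \<le> multiplicity p N" if "p \<in> prime_factors N" for p
    using that assms by (auto simp: prime_factors_multiplicity intro: dvd_imp_multiplicity_le)
  have "V N (C_div N) \<delta> = Upsilon N \<delta> 1 - Upsilon N \<delta> N"
    using delta[of 1 "Upsilon N \<delta>"] delta[of N "Upsilon N \<delta>"]
    by (simp add: V_def level_coeffs_C_div[OF assms(1)] right_diff_distrib sum_subtractf)
  also have "\<dots> = cusp_vec N \<delta>"
    unfolding Upsilon_def cusp_vec_def
    by (intro arg_cong2[of _ _ _ _ "(-)"] prod.cong) (auto simp: Upsilon_pp_first Upsilon_pp_last pos)
  finally show ?thesis .
qed

text \<open>The weight \<open>c\<close> is arbitrary so that the constant 1 and a parity indicator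
  are treated at once.\<close>

lemma sum_first_col:
  assumes "r > 0"
  shows "(\<Sum>e\<le>r. c e * first_col p e) = c 0 * int p - c 1"
proof -
  have "(\<Sum>e\<le>r. c e * first_col p e) = (\<Sum>e\<in>{0, 1}. c e * first_col p e)"
    using assms by (intro sum.mono_neutral_right) (auto simp: first_col_def)
  then show ?thesis by simp
qed

lemma sum_first_col_rev:
  assumes "r > 0"
  shows "(\<Sum>e\<le>r. c e * first_col p (r - e)) = c r * int p - c (r - 1)"
proof -
  have "(\<Sum>e\<le>r. c e * first_col p (r - e)) = (\<Sum>e\<in>{r, r - 1}. c e * first_col p (r - e))"
    using assms by (intro sum.mono_neutral_right) (auto simp: first_col_def)
  then show ?thesis using assms by simp
qed

definition odd_weight :: "nat \<Rightarrow> nat \<Rightarrow> int" where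
  "odd_weight N l = (int l + 1) * (\<Prod>q\<in>prime_factors N - {l}. int q - 1)"

text \<open>The parity condition at \<open>l\<close> is itself a product of weights over the primes,
  trivial away from \<open>l\<close>. Absorbed into the local factors, it lets both sums over
  divisors factor.\<close>

lemma sum_cusp_vec_odd:
  assumes "N > 0" "l \<in> prime_factors N"
  shows "(\<Sum>\<delta> | \<delta> dvd N \<and> odd (multiplicity l \<delta>). cusp_vec N \<delta>) =
         (if odd (multiplicity l N) then - odd_weight N l else 0)"
proof -
  let ?A = "prime_factors N"
  define c :: "nat \<Rightarrow> nat \<Rightarrow> int" where "c = (\<lambda>p e. of_bool (p = l \<longrightarrow> odd e))"
  have c: "c l e = of_bool (odd e)" "p \<noteq> l \<Longrightarrow> c p e = 1" for p e by (auto simp: c_def)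
  have prod_c: "(\<Prod>p\<in>?A. c p (e p)) = of_bool (odd (e l))" for e
    using assms(2) by (simp add: prod.remove[of ?A l] c)
  have r: "multiplicity p N > 0" if "p \<in> ?A" for p
    using that by (auto simp: prime_factors_multiplicity)
  have "(\<Sum>\<delta> | \<delta> dvd N \<and> odd (multiplicity l \<delta>). cusp_vec N \<delta>) =
        (\<Sum>\<delta> | \<delta> dvd N. (\<Prod>p\<in>?A. c p (multiplicity p \<delta>)) * cusp_vec N \<delta>)"
    using assms(1) by (intro sum.mono_neutral_cong_left) (auto simp: prod_c)
  also have "\<dots> = (\<Prod>p\<in>?A. \<Sum>e\<le>multiplicity p N. c p e * first_col p e) -
                 (\<Prod>p\<in>?A. \<Sum>e\<le>multiplicity p N. c p e * first_col p (multiplicity p N - e))"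
    using sum_divisors_prod[OF assms(1), of "\<lambda>p e. c p e * first_col p e"]
      sum_divisors_prod[OF assms(1), of "\<lambda>p e. c p e * first_col p (multiplicity p N - e)"]
    by (simp add: cusp_vec_def right_diff_distrib sum_subtractf flip: prod.distrib)
  also have "\<dots> = (\<Prod>p\<in>?A. c p 0 * int p - c p 1) -
                 (\<Prod>p\<in>?A. c p (multiplicity p N) * int p - c p (multiplicity p N - 1))"
    by (intro arg_cong2[of _ _ _ _ "(-)"] prod.cong refl sum_first_col sum_first_col_rev r)
  \<comment> \<open>Each \<open>q\<close> other than \<open>l\<close> contributes
    \<open>q - 1\<close> to both products. At \<open>l\<close> the first factor is
    \<open>- 1\<close>; the second is \<open>l\<close> if the exponent of \<open>l\<close> in
    \<open>N\<close> is odd, and \<open>- 1\<close> if it is even, when the products cancel.\<close>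
  also have "\<dots> = (if odd (multiplicity l N) then - odd_weight N l else 0)"
    using assms(2) r[OF assms(2)]
    by (auto simp: prod.remove[of ?A l] c odd_weight_def algebra_simps)
  finally show ?thesis .
qed

lemma GCD_div_C_div:
  assumes "N > 1"
  shows "GCD_div N (C_div N) = Gcd (cusp_vec N ` {\<delta>. \<delta> dvd N})"
  using V_C_div[OF assms] by (simp add: GCD_div_def cong: image_cong_simp)

lemma GCD_div_mult_Pw:
  assumes "N > 1" "l \<in> prime_factors N"
  shows "GCD_div N (C_div N) * Pw N l (C_div N) =
         (if odd (multiplicity l N) then - odd_weight N l else 0)"
proof -
  have "GCD_div N (C_div N) * VV N (C_div N) \<delta> = cusp_vec N \<delta>" if "\<delta> dvd N" for \<delta>
  proof -
    have "GCD_div N (C_div N) dvd V N (C_div N) \<delta>"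
      using that by (simp add: GCD_div_def)
    then show ?thesis using V_C_div[OF assms(1) that] by (simp add: VV_def)
  qed
  then show ?thesis
    using sum_cusp_vec_odd[of N l] assms by (simp add: Pw_def sum_distrib_left)
qed

text \<open>As the gcd is nonzero, the only candidate for \<open>w\<close> is
  \<open>- Pw N l (C_div N)\<close>, so its parity decides. Primes not dividing \<open>N\<close>
  give an empty sum, primes of even exponent give 0.\<close>

lemma h_div_C_div:
  assumes "N > 1" "GCD_div N (C_div N) \<noteq> 0"
  shows "h_div N (C_div N) =
    (if \<exists>l w. l \<in> prime_factors N \<and> odd (multiplicity l N) \<and> odd w \<and>
          odd_weight N l = GCD_div N (C_div N) * w then 2 else 1)"
proof -
  have outside: "even (Pw N l (C_div N))" if "prime l" "l \<notin> prime_factors N" for l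
  proof -
    have "{\<delta>. \<delta> dvd N \<and> odd (multiplicity l \<delta>)} = {}"
    proof safe
      fix \<delta> assume "\<delta> dvd N" "odd (multiplicity l \<delta>)"
      then have "l dvd N" by (metis dvd_trans even_zero not_dvd_imp_multiplicity_0)
      then show "\<delta> \<in> {}" using that assms(1) by (simp add: in_prime_factors_iff)
    qed
    then show ?thesis by (simp only: Pw_def) simp
  qed
  have "odd (Pw N l (C_div N)) \<longleftrightarrow> odd (multiplicity l N) \<and>
      (\<exists>w. odd w \<and> odd_weight N l = GCD_div N (C_div N) * w)" if "l \<in> prime_factors N" for l
  proof (cases "odd (multiplicity l N)")
    case True
    then have "odd_weight N l = GCD_div N (C_div N) * - Pw N l (C_div N)"
      using GCD_div_mult_Pw[OF assms(1) that] by simp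
    then have "odd_weight N l = GCD_div N (C_div N) * w \<longleftrightarrow> w = - Pw N l (C_div N)" for w
      using assms(2) by (metis mult_left_cancel)
    then show ?thesis using True by simp
  next
    case False
    then show ?thesis using GCD_div_mult_Pw[OF assms(1) that] assms(2) by auto
  qed
  then show ?thesis
    using outside unfolding h_div_def by (smt (verit) in_prime_factors_imp_prime)
qed

section \<open>The greatest common divisor\<close>

text \<open>The first product is the radical of \<open>N\<close>, hence at least 2. In the second
  every exponent is positive, so the factors are \<open>- 1\<close> or 0 and the absolute value is
  at most 1.\<close>

lemma cusp_vec_1_neq_0:
  assumes "N > 1"
  shows "cusp_vec N 1 \<noteq> 0"
proof -
  let ?A = "prime_factors N"
  have "?A \<noteq> {}" using assms by (simp add: prime_factorization_empty_iff)
  then obtain p where p: "p \<in> ?A" by blast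
  have ge: "int q \<ge> 1" if "q \<in> ?A" for q
    using that prime_ge_1_nat[of q] by auto
  have "1 * 2 \<le> (\<Prod>q\<in>?A - {p}. int q) * int p"
    using ge p prime_ge_2_nat[of p] by (intro mult_mono prod_ge_1 prod_nonneg) auto
  then have "(\<Prod>q\<in>?A. int q) \<ge> 2" using p by (simp add: prod.remove[of ?A p] mult.commute)
  moreover have "\<bar>\<Prod>q\<in>?A. first_col q (multiplicity q N)\<bar> \<le> 1"
    unfolding abs_prod
    by (intro prod_le_1) (auto simp: first_col_def prime_factors_multiplicity)
  ultimately show ?thesis by (simp add: cusp_vec_def)
qed

section \<open>The gcd at squarefree levels\<close>

lemma squarefree_multiplicity:
  fixes N :: nat
  assumes "squarefree N" "p \<in> prime_factors N"
  shows "multiplicity p N = 1"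
  using assms squarefree_factorial_semiring'[of N] by (cases "N = 0") auto

lemma squarefree_prod_prime_factors:
  fixes N :: nat
  assumes "squarefree N"
  shows "(\<Prod>p\<in>prime_factors N. p) = N"
proof -
  have "N > 0" using assms by (auto intro: Nat.gr0I)
  then have "(\<Prod>p\<in>prime_factors N. p ^ multiplicity p N) = N"
    by (rule prod_prime_factors_divisor) simp
  then show ?thesis using squarefree_multiplicity[OF assms] by simp
qed

text \<open>All exponents are 0 or 1, and scaling by \<open>d\<close> gives uniform local factors.
  Primes enter the second product only through squares, which are 1 modulo
  \<open>g_squarefree N\<close>.\<close>

lemma mult_cusp_vec_squarefree:
  assumes "squarefree N" "d dvd N"
  shows "int d * cusp_vec N d =
    int N * (\<Prod>p\<in>prime_factors N. (- 1) ^ multiplicity p d) -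
    (\<Prod>p\<in>prime_factors N. - ((- 1) ^ multiplicity p d * int p ^ (2 * multiplicity p d)))"
proof -
  let ?A = "prime_factors N"
  have N: "N > 0" using assms by (auto intro: Nat.gr0I)
  have r: "multiplicity p N = 1" if "p \<in> ?A" for p
    using squarefree_multiplicity[OF assms(1) that] .
  have e: "multiplicity p d = 0 \<or> multiplicity p d = 1" if "p \<in> ?A" for p
    using dvd_imp_multiplicity_le[OF assms(2), of p] r[OF that] N by auto
  have d: "int d = (\<Prod>p\<in>?A. int p ^ multiplicity p d)"
    using arg_cong[OF prod_prime_factors_divisor[OF N assms(2)], of int] by simp
  have N': "int N = (\<Prod>p\<in>?A. int p)"
    using arg_cong[OF squarefree_prod_prime_factors[OF assms(1)], of int] by simp
  have "int p ^ multiplicity p d * first_col p (multiplicity p d) =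
      int p * (- 1) ^ multiplicity p d" if "p \<in> ?A" for p
    using e[OF that] by auto
  then have "int d * (\<Prod>p\<in>?A. first_col p (multiplicity p d)) =
        int N * (\<Prod>p\<in>?A. (- 1) ^ multiplicity p d)"
    unfolding d N' prod.distrib[symmetric] by (intro prod.cong refl)
  moreover have "int p ^ multiplicity p d * first_col p (multiplicity p N - multiplicity p d) =
      - ((- 1) ^ multiplicity p d * int p ^ (2 * multiplicity p d))" if "p \<in> ?A" for p
    using e[OF that] r[OF that] by (auto simp: power2_eq_square)
  then have "int d * (\<Prod>p\<in>?A. first_col p (multiplicity p N - multiplicity p d)) =
        (\<Prod>p\<in>?A. - ((- 1) ^ multiplicity p d * int p ^ (2 * multiplicity p d)))"
    unfolding d prod.distrib[symmetric] by (intro prod.cong refl)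
  ultimately show ?thesis by (simp add: cusp_vec_def right_diff_distrib)
qed

text \<open>The entry at 1 is the generator \<open>N + (- 1) ^ (t - 1)\<close>, and together with it
  the entry at \<open>p\<close> yields \<open>p ^ 2 - 1\<close>. Conversely, modulo
  \<open>g_squarefree N\<close> the entry at \<open>d\<close>, scaled by \<open>d\<close>, becomes
  the first generator up to sign, and \<open>d\<close> is invertible.\<close>

lemma Gcd_cusp_vec_squarefree:
  assumes "squarefree N"
  shows "Gcd (cusp_vec N ` {d. d dvd N}) = g_squarefree N"
proof (cases "N = 1")
  \<comment> \<open>Both products are empty, so the vector is zero and its gcd is 0. This case is
    used later for \<open>M = 1\<close>, that is, at level \<open>p ^ 2\<close>.\<close>
  case True
  then show ?thesis by (simp add: g_squarefree_def cusp_vec_def)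
next
  case False
  let ?A = "prime_factors N"
  define t where "t = card ?A"
  define h where "h = int N + (- 1) ^ (t - 1)"
  have N: "N > 1" using False assms by (cases "N = 0") auto
  have "?A \<noteq> {}" using N by (simp add: prime_factorization_empty_iff)
  then have t: "t > 0" by (simp add: t_def card_gt_0_iff)
  then have sgn: "(- 1 :: int) ^ t = - ((- 1) ^ (t - 1))" by (cases t) auto
  have h: "cusp_vec N 1 = h"
    using mult_cusp_vec_squarefree[OF assms, of 1] by (simp add: h_def sgn flip: t_def)
  let ?G = "Gcd (cusp_vec N ` {d. d dvd N})" and ?g = "g_squarefree N"
  have g: "?g = Gcd (insert h ((\<lambda>p. int p ^ 2 - 1) ` ?A))"
    using False by (simp add: g_squarefree_def h_def t_def)
  have "?G dvd ?g"
    unfolding g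
  proof (rule Gcd_greatest)
    fix x assume "x \<in> insert h ((\<lambda>p. int p ^ 2 - 1) ` ?A)"
    then consider "x = h" | p where "p \<in> ?A" "x = int p ^ 2 - 1" by auto
    then show "?G dvd x"
    proof cases
      case 1
      show ?thesis using h 1 by (metis Gcd_dvd image_eqI mem_Collect_eq one_dvd)
    next
      case 2
      have pN: "p dvd N" "prime p" using 2(1) by auto
      have e: "multiplicity q p = (if q = p then 1 else 0)" if "q \<in> ?A" for q
        using that pN by (auto intro: prime_multiplicity_other)
      have "int p * cusp_vec N p =
          int N * (\<Prod>q\<in>?A. (- 1) ^ (if q = p then 1 else 0)) -
          (\<Prod>q\<in>?A. - ((- 1) ^ (if q = p then 1 else 0) * int q ^ (2 * (if q = p then 1 else 0))))"
        using mult_cusp_vec_squarefree[OF assms pN(1)] e by simp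
      also have "\<dots> = - int N - int p ^ 2 * (- 1) ^ (t - 1)"
        using 2(1) by (simp add: prod.remove[of ?A p] t_def)
      \<comment> \<open>With \<open>s = (- 1) ^ (t - 1)\<close> the second factor is
        \<open>s * (1 - p ^ 2)\<close>, and \<open>s * s = 1\<close>.\<close>
      finally have "x = - ((- 1) ^ (t - 1)) * (h + int p * cusp_vec N p)"
        using 2(2) by (cases "even (t - 1)") (auto simp: h_def)
      moreover have "?G dvd h" "?G dvd cusp_vec N p"
        using pN(1) by (auto simp flip: h)
      ultimately show ?thesis by auto
    qed
  qed
  moreover have "?g dvd ?G"
  proof (rule Gcd_greatest)
    fix x assume "x \<in> cusp_vec N ` {d. d dvd N}"
    then obtain d where d: "d dvd N" "x = cusp_vec N d" by auto
    have gh: "?g dvd h" unfolding g by (rule Gcd_dvd) simp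
    have gp: "[int p ^ 2 = 1] (mod ?g)" if "p \<in> ?A" for p
      unfolding cong_iff_dvd_diff g using that by (intro Gcd_dvd) auto
    have "[(\<Prod>p\<in>?A. - ((- 1) ^ multiplicity p d * int p ^ (2 * multiplicity p d))) =
          (\<Prod>p\<in>?A. - ((- 1) ^ multiplicity p d * 1))] (mod ?g)"
    proof (intro cong_prod)
      fix p assume "p \<in> ?A"
      then have "[(int p ^ 2) ^ multiplicity p d = 1 ^ multiplicity p d] (mod ?g)"
        by (intro cong_pow gp)
      then have "[int p ^ (2 * multiplicity p d) = 1] (mod ?g)" by (simp add: power_mult)
      then show "[- ((- 1) ^ multiplicity p d * int p ^ (2 * multiplicity p d)) =
          - ((- 1) ^ multiplicity p d * 1)] (mod ?g)"
        by (intro cong_uminus cong_scalar_left)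
    qed
    also have "(\<Prod>p\<in>?A. - ((- 1) ^ multiplicity p d * 1) :: int) =
        - ((- 1) ^ (t - 1)) * (\<Prod>p\<in>?A. (- 1) ^ multiplicity p d)"
      by (simp add: prod_uminus sgn flip: t_def)
    finally have "?g dvd (\<Prod>p\<in>?A. - ((- 1) ^ multiplicity p d * int p ^ (2 * multiplicity p d)))
        + (- 1) ^ (t - 1) * (\<Prod>p\<in>?A. (- 1) ^ multiplicity p d)"
      by (simp add: cong_iff_dvd_diff)
    moreover have "int d * x = h * (\<Prod>p\<in>?A. (- 1) ^ multiplicity p d) -
        ((\<Prod>p\<in>?A. - ((- 1) ^ multiplicity p d * int p ^ (2 * multiplicity p d)))
        + (- 1) ^ (t - 1) * (\<Prod>p\<in>?A. (- 1) ^ multiplicity p d))"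
      using mult_cusp_vec_squarefree[OF assms d(1)] d(2) by (simp add: h_def algebra_simps)
    ultimately have "?g dvd int d * x" using gh by simp
    \<comment> \<open>A common divisor divides both \<open>h\<close> and \<open>N\<close>, hence
      their difference, which is a sign.\<close>
    moreover have "coprime ?g (int d)"
    proof (rule coprimeI)
      fix k assume "k dvd ?g" "k dvd int d"
      then have "k dvd h - int N" using gh d(1) by (meson dvd_diff dvd_trans int_dvd_int_iff)
      then show "is_unit k" by (cases "even (t - 1)") (auto simp: h_def)
    qed
    ultimately show "?g dvd x" by (simp add: coprime_dvd_mult_right_iff)
  qed
  ultimately show ?thesis
    by (intro zdvd_antisym_nonneg) (auto simp: g)
qed

section \<open>The gcd at levels \<open>M * p ^ 2\<close> with \<open>M\<close> squarefree and prime
  to \<open>p\<close>\<close>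

lemma prime_factors_mult_prime_square:
  fixes M p :: nat
  assumes "M > 0" "prime p"
  shows "prime_factors (M * p ^ 2) = insert p (prime_factors M)"
  using assms by (simp add: prime_factors_product prime_factorization_prime_power prime_gt_0_nat)

lemma multiplicity_mult_prime_power:
  fixes d p q :: nat
  assumes "prime p" "\<not> p dvd d" "d > 0" "prime q"
  shows "multiplicity q (d * p ^ e) = (if q = p then e else multiplicity q d)"
  using assms by (auto simp: prime_elem_multiplicity_mult_distrib not_dvd_imp_multiplicity_0
      multiplicity_prime_power prime_multiplicity_other multiplicity_distinct_prime_power)

lemma cusp_vec_mult_prime_square:
  assumes "prime p" "coprime M p" "M > 0" "d dvd M"
  shows "cusp_vec (M * p ^ 2) (d * p ^ e) =
    first_col p e * (\<Prod>q\<in>prime_factors M. first_col q (multiplicity q d)) -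
    first_col p (2 - e) * (\<Prod>q\<in>prime_factors M. first_col q (multiplicity q M - multiplicity q d))"
proof -
  have pM: "\<not> p dvd M" using assms by (metis coprime_absorb_right not_prime_unit)
  then have pd: "\<not> p dvd d" and d0: "d > 0" using assms by (auto intro: Nat.gr0I)
  have p: "p \<notin> prime_factors M" using pM by auto
  have m: "multiplicity q (d * p ^ e) = multiplicity q d"
      "multiplicity q (M * p ^ 2) = multiplicity q M" if "q \<in> prime_factors M" for q
  proof -
    have "prime q" "q \<noteq> p" using that p by auto
    then show "multiplicity q (d * p ^ e) = multiplicity q d"
        "multiplicity q (M * p ^ 2) = multiplicity q M"
      using assms pM pd d0 by (simp_all add: multiplicity_mult_prime_power)
  qed
  have "multiplicity p (d * p ^ e) = e" "multiplicity p (M * p ^ 2) = 2"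
    using assms pM pd d0 by (auto simp: multiplicity_mult_prime_power)
  then show ?thesis
    using p m by (simp add: cusp_vec_def prime_factors_mult_prime_square[OF assms(3,1)])
qed

text \<open>The exponent 1 of \<open>p\<close> is its own reversal, so those entries reproduce the
  vector of \<open>M\<close> up to sign. At exponents 0 and 2 one product vanishes and the other
  contains \<open>p\<close>; the entry at \<open>M\<close> is \<open>p\<close> up to sign.\<close>

lemma Gcd_cusp_vec_mult_prime_square:
  assumes "prime p" "coprime M p" "squarefree M"
  shows "Gcd (cusp_vec (M * p ^ 2) ` {d. d dvd M * p ^ 2}) = gcd (int p) (g_squarefree M)"
proof -
  let ?G = "Gcd (cusp_vec (M * p ^ 2) ` {d. d dvd M * p ^ 2})"
  have M: "M > 0" using assms by (auto intro: Nat.gr0I)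
  note cv = cusp_vec_mult_prime_square[OF assms(1,2) M]
  have mem: "?G dvd cusp_vec (M * p ^ 2) (d * p ^ e)" if "d dvd M" "e \<le> 2" for d e
  proof -
    have "d * p ^ e dvd M * p ^ 2"
      using that by (intro mult_dvd_mono le_imp_power_dvd)
    then show ?thesis by (intro Gcd_dvd imageI) simp
  qed
  have mid: "cusp_vec (M * p ^ 2) (d * p ^ 1) = - cusp_vec M d" if "d dvd M" for d
    unfolding cv[OF that] by (simp add: cusp_vec_def)
  have "?G dvd gcd (int p) (g_squarefree M)"
  proof (rule gcd_greatest)
    have "cusp_vec (M * p ^ 2) (M * p ^ 0) = int p * (\<Prod>q\<in>prime_factors M. - 1)"
      unfolding cv[OF dvd_refl] using squarefree_multiplicity[OF assms(3)]
      by (simp add: first_col_def)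
    then have "?G dvd int p * (- 1) ^ card (prime_factors M)"
      using mem[of M 0] by simp
    then show "?G dvd int p"
      by (cases "even (card (prime_factors M))") auto
    show "?G dvd g_squarefree M"
      unfolding Gcd_cusp_vec_squarefree[OF assms(3), symmetric]
    proof (rule Gcd_greatest, safe)
      fix d assume "d dvd M"
      then show "?G dvd cusp_vec M d" using mem[of d 1] mid[of d] by simp
    qed
  qed
  moreover have "gcd (int p) (g_squarefree M) dvd ?G"
  proof (rule Gcd_greatest, safe)
    fix x assume "x dvd M * p ^ 2"
    then obtain d y where d: "x = d * y" "d dvd M" "y dvd p ^ 2"
      by (metis division_decomp)
    then obtain e where e: "e \<le> 2" "y = p ^ e"
      using assms(1) divides_primepow_nat by blast
    show "gcd (int p) (g_squarefree M) dvd cusp_vec (M * p ^ 2) x"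
    proof (cases "e = 1")
      case True
      have "g_squarefree M dvd cusp_vec M d"
        unfolding Gcd_cusp_vec_squarefree[OF assms(3), symmetric] using d(2) by (intro Gcd_dvd) auto
      then show ?thesis using mid[OF d(2)] d(1) e(2) True
        by (metis dvd_minus_iff dvd_trans gcd_dvd2)
    next
      case False
      then have "e = 0 \<or> e = 2" using e(1) by auto
      then have "int p dvd cusp_vec (M * p ^ 2) (d * p ^ e)"
        unfolding cv[OF d(2)] by (auto simp: first_col_def)
      then show ?thesis using d(1) e(2) by (metis dvd_trans gcd_dvd1)
    qed
  qed
  ultimately show ?thesis by (intro zdvd_antisym_nonneg) auto
qed

section \<open>The gcd at the remaining levels\<close>

lemma not_squarefree_cases:
  assumes "N > 0" "\<not> squarefree N" "\<not> (\<exists>M p. sqfree_times_sq N M p)"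
  obtains p where "p \<in> prime_factors N" "multiplicity p N \<ge> 3"
  | p q where "p \<in> prime_factors N" "q \<in> prime_factors N" "p \<noteq> q"
      "multiplicity p N \<ge> 2" "multiplicity q N \<ge> 2"
proof -
  obtain p where p: "prime p" "multiplicity p N \<ge> 2"
    using assms(1,2) squarefree_factorial_semiring''[of N]
    by (metis Suc_1 gr_implies_not0 not_less_eq_eq)
  then have pN: "p \<in> prime_factors N" by (simp add: prime_factors_multiplicity)
  show thesis
  proof (cases "multiplicity p N = 2")
    case False
    then show ?thesis using that(1)[OF pN] p(2) by simp
  next
    case True
    obtain M where M: "N = p ^ 2 * M" "\<not> p dvd M"
      using multiplicity_decompose'[of N p] assms(1) p(1) True
      by (metis not_prime_unit gr_implies_not0)
    have cop: "coprime M p" using M(2) p(1) by (metis coprime_commute prime_imp_coprime)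
    \<comment> \<open>Otherwise \<open>M\<close> and \<open>p\<close> would form an excluded pair.
      So \<open>M\<close> supplies a second repeated prime, distinct from \<open>p\<close> because
      \<open>p\<close> does not divide \<open>M\<close>.\<close>
    have "\<not> squarefree M"
      using assms(3) M p(1) cop by (auto simp: sqfree_times_sq_def mult.commute)
    moreover have "M > 0" using M(1) assms(1) by (auto intro: Nat.gr0I)
    ultimately obtain q where q: "prime q" "multiplicity q M \<ge> 2"
      using squarefree_factorial_semiring''[of M] by (metis Suc_1 gr_implies_not0 not_less_eq_eq)
    have ne: "p \<noteq> q" using q(2) M(2) not_dvd_imp_multiplicity_0[of p M] by auto
    have "multiplicity q N \<ge> 2"
      using q dvd_imp_multiplicity_le[of M N q] M(1) assms(1) by (metis dvd_triv_right gr_implies_not0 le_trans)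
    then show ?thesis
      using that(2)[OF pN _ ne p(2)] q(1) by (simp add: prime_factors_multiplicity)
  qed
qed

text \<open>Exponents 0 and 1 are chosen so that some reversed exponent is at least 2: the second
  product vanishes and the first is a monomial up to sign. A prime of exponent at least 3 gives a
  unit entry; two primes of exponent at least 2 give two coprime entries.\<close>

lemma Gcd_cusp_vec_other:
  assumes "N > 0" "\<not> squarefree N" "\<not> (\<exists>M p. sqfree_times_sq N M p)"
  shows "Gcd (cusp_vec N ` {d. d dvd N}) = 1"
proof -
  let ?A = "prime_factors N" and ?G = "Gcd (cusp_vec N ` {d. d dvd N})"
  have r: "multiplicity p N \<ge> 1" if "p \<in> ?A" for p
    using that by (auto simp: prime_factors_multiplicity)
  have key: "?G dvd (\<Prod>q\<in>?A. first_col q (f q))"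
    if f: "\<And>q. q \<in> ?A \<Longrightarrow> f q \<le> 1" and p: "p \<in> ?A" "multiplicity p N \<ge> f p + 2" for f p
  proof -
    obtain d where d: "d dvd N" "\<And>q. q \<in> ?A \<Longrightarrow> multiplicity q d = f q"
      using obtain_divisor_multiplicity[of N f] assms(1) f r by (metis le_trans)
    have "first_col p (multiplicity p N - multiplicity p d) = 0"
      using p d(2)[OF p(1)] by (auto simp: first_col_def)
    then have "cusp_vec N d = (\<Prod>q\<in>?A. first_col q (f q))"
      using p(1) d(2) by (auto simp: cusp_vec_def prod_zero_iff)
    then show ?thesis using d(1) by (metis (mono_tags) Gcd_dvd imageI mem_Collect_eq)
  qed
  have "?G dvd 1"
    using assms
  proof (cases rule: not_squarefree_cases)
    case (1 p)
    then have "?G dvd (- 1) ^ card ?A"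
      using key[of "\<lambda>_. 1" p] by simp
    then show ?thesis by (cases "even (card ?A)") auto
  next
    case (2 p q)
    have dvd: "?G dvd int u" if u: "u \<in> ?A" "multiplicity u N \<ge> 2" for u
    proof -
      have "?G dvd (\<Prod>q\<in>?A. first_col q (if q = u then 0 else 1))"
        using key[of "\<lambda>q. if q = u then 0 else 1" u] u by simp
      also have "\<dots> = int u * (- 1) ^ (card ?A - 1)"
        using u(1) by (simp add: prod.remove[of ?A u])
      finally show ?thesis by (cases "even (card ?A - 1)") auto
    qed
    have "coprime (int p) (int q)"
      using 2 by (auto intro: primes_coprime)
    then show ?thesis using dvd[of p] dvd[of q] 2 by (meson coprime_def)
  qed
  then show ?thesis by (intro zdvd_antisym_nonneg) auto
qed

lemma GCD_div_C_div_eq_g_num: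
  assumes "N > 1"
  shows "GCD_div N (C_div N) = g_num N"
proof -
  consider "squarefree N" | M p where "sqfree_times_sq N M p" "\<not> squarefree N"
    | "\<not> squarefree N" "\<not> (\<exists>M p. sqfree_times_sq N M p)" by blast
  then show ?thesis
  proof cases
    case 1
    then show ?thesis
      by (simp add: GCD_div_C_div[OF assms] Gcd_cusp_vec_squarefree g_num_def)
  next
    case 2
    then have *: "N = M * p ^ 2" "prime p" "coprime M p" "squarefree M"
      by (auto simp: sqfree_times_sq_def)
    then have "g_num N = gcd (int p) (g_squarefree M)"
      using g_num_sqfree_times_sq[OF *] by (simp add: g_num_def)
    then show ?thesis
      using * Gcd_cusp_vec_mult_prime_square[of p M] GCD_div_C_div[OF assms] by simp
  next
    case 3
    then have "g_num N = 1" by (simp only: g_num_def if_False)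
    then show ?thesis
      using assms 3 by (simp add: GCD_div_C_div Gcd_cusp_vec_other)
  qed
qed

lemma GCD_div_C_div_neq_0:
  assumes "N > 1"
  shows "GCD_div N (C_div N) \<noteq> 0"
  using cusp_vec_1_neq_0[OF assms] by (auto simp: GCD_div_C_div[OF assms])

section \<open>Parity of the power sums\<close>

lemma even_prime_nat_iff:
  assumes "prime (p :: nat)"
  shows "even p \<longleftrightarrow> p = 2"
  using assms primes_dvd_imp_eq[of 2 p] by auto

lemma odd_weight_eq_prod:
  assumes "p \<in> prime_factors N" "p \<noteq> l"
  shows "odd_weight N l = (int p - 1) * ((int l + 1) * (\<Prod>q\<in>prime_factors N - {l} - {p}. int q - 1))"
  using assms by (simp add: odd_weight_def prod.remove[of "prime_factors N - {l}" p])

lemma g_num_dvd_odd_weight: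
  assumes "N > 1" "l \<in> prime_factors N" "odd (multiplicity l N)"
  shows "g_num N dvd odd_weight N l"
  using GCD_div_mult_Pw[OF assms(1,2)] assms(3) GCD_div_C_div_eq_g_num[OF assms(1)]
  by (metis dvd_minus_iff dvd_triv_left)

text \<open>The quotient \<open>odd_weight N l / g_num N\<close> is \<open>- Pw N l (C_div N)\<close> when
  \<open>multiplicity l N\<close> is odd.\<close>

definition has_odd_quotient :: "nat \<Rightarrow> bool" where
  "has_odd_quotient N \<longleftrightarrow> (\<exists>l w. l \<in> prime_factors N \<and> odd (multiplicity l N) \<and> odd w \<and>
     odd_weight N l = g_num N * w)"

lemma has_odd_quotientI:
  assumes "l \<in> prime_factors N" "odd (multiplicity l N)" "odd w" "odd_weight N l = g_num N * w"
  shows "has_odd_quotient N"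
  using assms by (auto simp: has_odd_quotient_def)

lemma h_div_eq:
  assumes "N > 1"
  shows "h_div N (C_div N) = (if has_odd_quotient N then 2 else 1)"
  using h_div_C_div[OF assms GCD_div_C_div_neq_0[OF assms]]
  by (simp add: has_odd_quotient_def GCD_div_C_div_eq_g_num[OF assms])

section \<open>Odd quotients at levels that are not squarefree\<close>

lemma has_odd_quotient_other:
  assumes "N > 1" "\<not> squarefree N" "\<not> (\<exists>M p. sqfree_times_sq N M p)"
  shows "has_odd_quotient N \<longleftrightarrow> (\<exists>r. odd r \<and> N = 2 ^ r)"
proof
  \<comment> \<open>With gcd 1 the weight itself must be odd: \<open>l + 1\<close> odd forces
    \<open>l = 2\<close>, and the even factors \<open>q - 1\<close> rule out any other prime
    \<open>q\<close>.\<close>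
  have g: "g_num N = 1" using assms by (simp only: g_num_def if_False)
  {
    assume "has_odd_quotient N"
    then obtain l where l: "l \<in> prime_factors N" "odd (multiplicity l N)" "odd (odd_weight N l)"
      by (auto simp: has_odd_quotient_def g)
    have "even l" using l(3) by (auto simp: odd_weight_def)
    then have l2: "l = 2" using l(1) by (simp add: even_prime_nat_iff in_prime_factors_imp_prime)
    have "p = 2" if "p \<in> prime_factors N" for p
    proof (rule ccontr)
      assume "p \<noteq> 2"
      then have "odd p" using that by (simp add: even_prime_nat_iff in_prime_factors_imp_prime)
      then have "even (int p - 1)" by simp
      then show False using odd_weight_eq_prod[OF that, of l] \<open>p \<noteq> 2\<close> l2 l(3) by simp
    qed
    then have "prime_factors N = {2}" using l(1) l2 by blast
    then have "N = 2 ^ multiplicity 2 N"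
      using prod_prime_factors_divisor[of N N] assms(1) by simp
    then show "\<exists>r. odd r \<and> N = 2 ^ r" using l(2) unfolding l2 by blast
  }
  {
    assume "\<exists>r. odd r \<and> N = 2 ^ r"
    then obtain r where r: "odd r" "N = 2 ^ r" by auto
    then have "r > 0" by (simp add: odd_pos)
    then have pf: "prime_factors N = {2}" "multiplicity 2 N = r"
      using r(2) by (auto simp: prime_factorization_prime_power)
    show "has_odd_quotient N"
      by (rule has_odd_quotientI[of 2 N 3]) (auto simp: pf r(1) g odd_weight_def)
  }
qed

text \<open>Since \<open>p\<close> has even exponent, \<open>l\<close> divides \<open>M\<close> and
  \<open>p - 1\<close> divides the weight, whereas the gcd divides \<open>p\<close>. Comparing
  parities leaves \<open>p = 2\<close> with gcd 2, and the weight must be 2 modulo 4.\<close>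

lemma has_odd_quotient_sqfree_times_sq:
  assumes "sqfree_times_sq N M p"
  shows "has_odd_quotient N \<longleftrightarrow> (\<exists>q. prime q \<and> q mod 4 = 1 \<and> N = 4 * q)"
proof
  have N: "N = M * p ^ 2" "prime p" "coprime M p" "squarefree M"
    using assms by (auto simp: sqfree_times_sq_def)
  have M: "M > 0" using N(4) by (auto intro: Nat.gr0I)
  have g: "g_num N = gcd (int p) (g_num M)" using g_num_sqfree_times_sq[OF N] .
  have pM: "\<not> p dvd M" using N by (metis coprime_absorb_right not_prime_unit)
  have pf: "prime_factors N = insert p (prime_factors M)" "p \<notin> prime_factors M"
    using prime_factors_mult_prime_square[OF M N(2)] N(1) pM by auto
  have mp: "multiplicity p N = 2"
    using multiplicity_mult_prime_power[of p M p 2] N pM M by simp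
  {
    assume "has_odd_quotient N"
    then obtain l w where l: "l \<in> prime_factors N" "odd (multiplicity l N)" "odd w"
        "odd_weight N l = g_num N * w"
      unfolding has_odd_quotient_def by blast
    have lp: "l \<noteq> p" using l(2) mp by auto
    then have lM: "l \<in> prime_factors M" using l(1) pf by auto
    have w: "odd_weight N l = (int p - 1) * odd_weight M l"
      using lp pf by (simp add: odd_weight_def insert_Diff_if)
    have p2: "p = 2"
    proof (rule ccontr)
      assume "p \<noteq> 2"
      then have "odd p" using N(2) by (simp add: even_prime_nat_iff)
      moreover have "g_num N dvd int p" by (simp add: g)
      ultimately have "odd (g_num N * w)" using l(3) by (metis dvd_trans even_mult_iff even_of_nat)
      moreover have "even (odd_weight N l)" using w \<open>odd p\<close> by simp
      ultimately show False using l(4) by metis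
    qed
    have oddM: "odd q" if "q \<in> prime_factors M" for q
      using that pM p2 by (metis in_prime_factors_iff even_prime_nat_iff)
    have "M > 1" using lM M by (cases "M = 1") auto
    then have "even (g_num M)"
      unfolding g_num_squarefree[OF \<open>M > 1\<close> N(4)] using oddM pM p2
      by (intro Gcd_greatest) auto
    then have g2: "g_num N = 2" by (simp add: g p2 gcd_proj1_if_dvd)
    \<comment> \<open>A second prime \<open>q\<close> of \<open>M\<close> would put the even factors
      \<open>q - 1\<close> and \<open>l + 1\<close> into the weight, which is \<open>2 * w\<close>
      with \<open>w\<close> odd.\<close>
    have "q = l" if "q \<in> prime_factors M" for q
    proof (rule ccontr)
      assume "q \<noteq> l"
      have "2 * 2 dvd (int q - 1) * (int l + 1)"
        using oddM[OF that] oddM[OF lM] by (intro mult_dvd_mono) auto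
      then have "2 * 2 dvd odd_weight M l"
        using odd_weight_eq_prod[OF that \<open>q \<noteq> l\<close>] by (metis dvd_mult2 mult.assoc)
      then have "4 dvd 2 * w" using l(4) w p2 g2 by simp
      then show False using l(3) by presburger
    qed
    then have "prime_factors M = {l}" using lM by blast
    then have Ml: "M = l" "odd_weight M l = int l + 1"
      using squarefree_prod_prime_factors[OF N(4)] by (auto simp: odd_weight_def)
    have "int l + 1 = 2 * w" using l(4) w p2 g2 Ml by simp
    then have "l mod 4 = 1" using l(3) by presburger
    then show "\<exists>q. prime q \<and> q mod 4 = 1 \<and> N = 4 * q"
      using lM N(1) Ml p2 by (intro exI[of _ l]) auto
  }
  {
    assume "\<exists>q. prime q \<and> q mod 4 = 1 \<and> N = 4 * q"
    then obtain q where q: "prime q" "q mod 4 = 1" "N = 4 * q" by auto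
    have "odd q" using q(2) by presburger
    then have "sqfree_times_sq N q 2"
      using q by (auto simp: sqfree_times_sq_def squarefree_prime coprime_right_2_iff_odd)
    then have M2: "M = q" "p = 2" using sqfree_times_sq_unique[OF assms] by auto
    have pfq: "prime_factors q = {q}" using q(1) by (rule prime_prime_factors)
    have "even (g_num q)"
      unfolding g_num_squarefree[OF prime_gt_1_nat[OF q(1)] squarefree_prime[OF q(1)]]
      using \<open>odd q\<close> by (intro Gcd_greatest) (auto simp: pfq)
    then have g2: "g_num N = 2" by (simp add: g M2 gcd_proj1_if_dvd)
    have mq: "multiplicity q N = 1"
      using multiplicity_mult_prime_power[of 2 q q 2] q \<open>odd q\<close>
      by (auto simp: prime_gt_0_nat mult.commute)
    have "prime_factors N - {q} = {2}" using pf pfq M2 q \<open>odd q\<close> by auto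
    then have w: "odd_weight N q = int q + 1" by (simp add: odd_weight_def)
    obtain k where k: "q = 4 * k + 1" using q(2) by (metis mult.commute mod_mult_div_eq add.commute)
    show "has_odd_quotient N"
      \<comment> \<open>The weight is \<open>q + 1 = 2 * (2 * k + 1)\<close> and the gcd is
        2.\<close>
      by (rule has_odd_quotientI[of q N "2 * int k + 1"])
         (use pf pfq M2 mq w g2 k in auto)
  }
qed

section \<open>Odd quotients at squarefree levels\<close>

lemma has_odd_quotient_prime:
  assumes "prime N"
  shows "has_odd_quotient N"
proof -
  have pf: "prime_factors N = {N}" using assms by (rule prime_prime_factors)
  \<comment> \<open>For a single prime the sign is positive, so \<open>N + 1\<close> is one
    generator and divides the other. It is therefore the gcd, and it equals the weight.\<close>
  have "int N + 1 dvd int N ^ 2 - 1"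
    by (rule dvdI[of _ _ "int N - 1"]) (simp add: power2_eq_square algebra_simps)
  then have "g_num N = int N + 1"
    using g_num_squarefree[OF prime_gt_1_nat[OF assms] squarefree_prime[OF assms]]
    by (simp add: pf gcd_proj1_if_dvd)
  then show ?thesis
    by (intro has_odd_quotientI[of N N 1])
       (use assms in \<open>auto simp: pf odd_weight_def\<close>)
qed

text \<open>The prime 2 puts \<open>2 ^ 2 - 1 = 3\<close> among the generators, so gcd and weight
  are odd. Then \<open>l = 2\<close>, but a second prime \<open>q\<close> contributes the even
  factor \<open>q - 1\<close>.\<close>

lemma not_has_odd_quotient_even_squarefree:
  assumes "squarefree N" "even N" "\<not> prime N"
  shows "\<not> has_odd_quotient N"
proof
  assume "has_odd_quotient N"
  then obtain l w where l: "l \<in> prime_factors N" "odd w" "odd_weight N l = g_num N * w"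
    unfolding has_odd_quotient_def by blast
  have N0: "N > 0" using assms by (auto intro: Nat.gr0I)
  then have N: "N > 1" using assms(2) by (cases "N = 1") auto
  have two: "2 \<in> prime_factors N" using assms N0 by (simp add: in_prime_factors_iff)
  have "g_num N dvd int 2 ^ 2 - 1"
    unfolding g_num_squarefree[OF N assms(1)] using two by (intro Gcd_dvd) blast
  then have "g_num N dvd 3" by simp
  then have "odd (g_num N)" by (metis dvd_trans odd_numeral)
  then have odd: "odd (odd_weight N l)" using l by simp
  then have "even l" by (auto simp: odd_weight_def)
  then have l2: "l = 2" using l(1) by (simp add: even_prime_nat_iff in_prime_factors_imp_prime)
  have "prime_factors N \<noteq> {2}"
    using squarefree_prod_prime_factors[OF assms(1)] assms(3) by auto
  then obtain q where q: "q \<in> prime_factors N" "q \<noteq> 2" using two by auto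
  then have "odd q" by (simp add: even_prime_nat_iff in_prime_factors_imp_prime)
  then show False using odd_weight_eq_prod[OF q(1), of l] q(2) l2 odd by simp
qed

text \<open>If \<open>odd_weight N l = g * w\<close> with \<open>w\<close> odd, then \<open>g dvd q ^ 2 - 1\<close> bounds the 2-adic valuation of
  the weight; this forces \<open>l = 1\<close> and \<open>q = - 1\<close> modulo \<open>4\<close> for the other primes \<open>q\<close>, so that
  \<open>N + (- 1) ^ (t - 1)\<close> is \<open>2\<close> modulo \<open>4\<close> although \<open>g\<close>, a multiple of \<open>4\<close>, divides it.\<close>

lemma not_has_odd_quotient_three_primes:
  assumes "squarefree N" "odd N" "card (prime_factors N) \<ge> 3"
  shows "\<not> has_odd_quotient N"
proof
  let ?A = "prime_factors N"
  define t where "t = card ?A"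
  assume "has_odd_quotient N"
  then obtain l w where l: "l \<in> ?A" "odd w" "odd_weight N l = g_num N * w"
    unfolding has_odd_quotient_def by blast
  define B where "B = ?A - {l}"
  have B: "finite B" "card B = t - 1" "t - 1 \<ge> 2"
    using l(1) assms(3) by (auto simp: B_def t_def)
  have N: "N > 1" using assms by (cases "N = 0 \<or> N = 1") auto
  have odd: "odd q" if "q \<in> ?A" for q
    using that assms(2) by (metis dvd_trans in_prime_factors_iff)
  have g: "g_num N dvd int N + (- 1) ^ (t - 1)" "\<And>q. q \<in> ?A \<Longrightarrow> g_num N dvd int q ^ 2 - 1"
    unfolding g_num_squarefree[OF N assms(1)] t_def by (rule Gcd_dvd, blast)+
  have w4: "4 dvd x" if "4 dvd x * w" for x
  proof -
    have "coprime 4 w"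
      using l(2) coprime_mult_left_iff[of 2 2 w] by (simp add: coprime_left_2_iff_odd)
    then show ?thesis using that by (simp add: coprime_dvd_mult_left_iff)
  qed
  have weight_dvd: "odd_weight N l dvd (int q ^ 2 - 1) * w" if "q \<in> ?A" for q
    unfolding l(3) using g(2)[OF that] by (intro mult_dvd_mono) auto
  \<comment> \<open>Here at least three primes are needed: \<open>B\<close> retains an odd prime
    after \<open>q\<close> is removed.\<close>
  have evenB: "2 dvd (\<Prod>r\<in>B - {q}. int r - 1)" if "q \<in> B" for q
  proof -
    have "card (B - {q}) > 0" using that B by simp
    then obtain r where r: "r \<in> B - {q}" by (metis card_gt_0_iff ex_in_conv)
    then have "2 dvd int r - 1" using odd[of r] by (auto simp: B_def)
    moreover have "int r - 1 dvd (\<Prod>r\<in>B - {q}. int r - 1)"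
      using r B(1) by (intro dvd_prodI) auto
    ultimately show ?thesis by (rule dvd_trans)
  qed
  have l1: "[int l = 1] (mod 4)"
  proof -
    obtain q where q: "q \<in> B" using B by (metis card.empty ex_in_conv not_numeral_le_zero)
    have "2 * 2 dvd (int q - 1) * (\<Prod>r\<in>B - {q}. int r - 1)"
      using q odd[of q] by (intro mult_dvd_mono evenB) (auto simp: B_def)
    then have "4 dvd (\<Prod>r\<in>B. int r - 1)"
      using q B(1) by (simp add: prod.remove[of B q])
    \<comment> \<open>The factor \<open>l + 1\<close> of the weight cancels against
      \<open>l ^ 2 - 1\<close>.\<close>
    moreover have "(int l + 1) * (\<Prod>r\<in>B. int r - 1) dvd (int l + 1) * ((int l - 1) * w)"
      using weight_dvd[OF l(1)] by (simp add: odd_weight_def B_def power2_eq_square algebra_simps)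
    then have "(\<Prod>r\<in>B. int r - 1) dvd (int l - 1) * w"
      by (subst (asm) dvd_mult_cancel_left) linarith
    ultimately show ?thesis
      unfolding cong_iff_dvd_diff by (metis dvd_trans w4)
  qed
  have q3: "[int q = - 1] (mod 4)" if "q \<in> B" for q
  proof -
    have q: "q \<in> ?A" "q \<noteq> l" using that by (auto simp: B_def)
    \<comment> \<open>Now \<open>q - 1\<close> cancels against \<open>q ^ 2 - 1\<close>, leaving the
      even factors \<open>l + 1\<close> and some \<open>r - 1\<close>.\<close>
    have "(int q - 1) * ((int l + 1) * (\<Prod>r\<in>B - {q}. int r - 1)) dvd (int q - 1) * ((int q + 1) * w)"
      using weight_dvd[OF q(1)]
      by (simp add: odd_weight_eq_prod[OF q] B_def power2_eq_square algebra_simps)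
    moreover have "int q - 1 \<noteq> 0"
      using prime_gt_1_nat[OF in_prime_factors_imp_prime[OF q(1)]] by simp
    ultimately have "(int l + 1) * (\<Prod>r\<in>B - {q}. int r - 1) dvd (int q + 1) * w"
      by (metis dvd_mult_cancel_left)
    moreover have "2 * 2 dvd (int l + 1) * (\<Prod>r\<in>B - {q}. int r - 1)"
      using odd[OF l(1)] by (intro mult_dvd_mono evenB that) auto
    ultimately have "4 dvd (int q + 1) * w" by (metis dvd_trans mult_2 numeral_Bit0)
    then show ?thesis using w4[of "int q + 1"] by (simp add: cong_iff_dvd_diff)
  qed
  have "int N = int l * (\<Prod>q\<in>B. int q)"
    using arg_cong[OF squarefree_prod_prime_factors[OF assms(1)], of int] l(1)
    by (simp add: B_def prod.remove[of ?A l])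
  also have "[int l * (\<Prod>q\<in>B. int q) = 1 * (\<Prod>q\<in>B. - 1)] (mod 4)"
    by (intro cong_mult cong_prod l1 q3)
  finally have N4: "4 dvd int N - (- 1) ^ (t - 1)" by (simp add: B(2) cong_iff_dvd_diff)
  obtain q where q: "q \<in> B" using B by (metis card.empty ex_in_conv not_numeral_le_zero)
  then have q': "q \<in> ?A" "q \<noteq> l" by (auto simp: B_def)
  have "2 * 2 dvd (int q - 1) * ((int l + 1) * (\<Prod>r\<in>?A - {l} - {q}. int r - 1))"
    using odd[OF q'(1)] odd[OF l(1)] by (intro mult_dvd_mono dvd_mult2) auto
  then have "4 dvd odd_weight N l" unfolding odd_weight_eq_prod[OF q'] by simp
  then have "4 dvd g_num N" unfolding l(3) by (rule w4)
  then have "4 dvd int N + (- 1) ^ (t - 1)" using g(1) by (rule dvd_trans)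
  \<comment> \<open>The two multiples of 4 differ by \<open>2 * (- 1) ^ (t - 1)\<close>.\<close>
  then have "4 dvd (int N + (- 1) ^ (t - 1)) - (int N - (- 1) ^ (t - 1))" using N4 by (rule dvd_diff)
  then show False by (cases "even (t - 1)") auto
qed

text \<open>Agreement one power of 2 beyond the valuation of \<open>x\<close> transfers both the
  divisibility and its failure at the next power.\<close>

lemma multiplicity_two_cong:
  fixes x y :: nat
  assumes "x > 0" "2 ^ Suc (multiplicity 2 x) dvd int x - int y"
  shows "multiplicity 2 x = multiplicity 2 y"
proof (rule multiplicity_eqI[symmetric])
  let ?b = "multiplicity 2 x"
  have x: "2 ^ ?b dvd int x"
    using multiplicity_dvd[of 2 x] by (metis int_dvd_int_iff of_nat_numeral of_nat_power)
  have "2 ^ ?b dvd int x - (int x - int y)"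
    by (intro dvd_diff x dvd_trans[OF le_imp_power_dvd assms(2)]) simp
  then have "2 ^ ?b dvd int y" by simp
  then show "2 ^ ?b dvd y" by (metis int_dvd_int_iff of_nat_numeral of_nat_power)
  show "\<not> 2 ^ Suc ?b dvd y"
  proof
    assume "2 ^ Suc ?b dvd y"
    then have "2 ^ Suc ?b dvd int y" by (metis int_dvd_int_iff of_nat_numeral of_nat_power)
    then have "2 ^ Suc ?b dvd (int x - int y) + int y" using assms(2) by (intro dvd_add)
    then have "2 ^ Suc ?b dvd int x" by simp
    then have "2 ^ Suc ?b dvd x" by (metis int_dvd_int_iff of_nat_numeral of_nat_power)
    then show False using assms(1) by (simp add: power_dvd_iff_le_multiplicity del: power_Suc)
  qed
qed

text \<open>The point is that the weight and \<open>g\<close> have the same 2-part, which therefore divides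
  \<open>(p * q - 1) - (p + 1) * (q - 1) = p - q\<close>.\<close>

lemma two_primes_multiplicity:
  fixes p q :: nat and g w :: int
  assumes pq: "odd p" "odd q" "p > 1" "q > 1"
    and g: "g dvd int p * int q - 1" and w: "odd w" "(int p + 1) * (int q - 1) = g * w"
  shows "multiplicity 2 (p - 1) = multiplicity 2 (q - 1)"
    and "multiplicity 2 (p + 1) = multiplicity 2 (q + 1)"
proof -
  let ?b = "multiplicity 2 (p + 1)" and ?c = "multiplicity 2 (q - 1)"
  have bc: "?b \<ge> 1" "?c \<ge> 1" using pq by (auto intro!: multiplicity_geI)
  have "(2::nat) ^ ?b * 2 ^ ?c dvd (p + 1) * (q - 1)"
    by (intro mult_dvd_mono multiplicity_dvd)
  then have "int (2 ^ ?b * 2 ^ ?c) dvd int ((p + 1) * (q - 1))" by (simp only: int_dvd_int_iff)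
  moreover have "int ((p + 1) * (q - 1)) = (int p + 1) * (int q - 1)"
    unfolding of_nat_mult using pq by (simp add: of_nat_diff add.commute)
  ultimately have W: "2 ^ (?b + ?c) dvd (int p + 1) * (int q - 1)"
    by (simp add: power_add)
  have "2 ^ (?b + ?c) dvd g"
    using W w by (auto simp: coprime_dvd_mult_left_iff coprime_left_2_iff_odd)
  then have "2 ^ (?b + ?c) dvd (int p * int q - 1) - (int p + 1) * (int q - 1)"
    using dvd_diff[OF dvd_trans[OF _ g] W] by blast
  then have d: "2 ^ (?b + ?c) dvd int p - int q" by (simp add: algebra_simps)
  \<comment> \<open>As \<open>?b\<close> and \<open>?c\<close> are positive, \<open>?b + ?c\<close>
    exceeds each of them; this is the extra power that \<open>multiplicity_two_cong\<close>
    demands.\<close>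
  have "2 ^ Suc ?b dvd int p - int q" "2 ^ Suc ?c dvd int p - int q"
    using bc by (auto intro!: dvd_trans[OF le_imp_power_dvd d] simp del: power_Suc)
  then have "2 ^ Suc ?b dvd int (p + 1) - int (q + 1)" "2 ^ Suc ?c dvd int (q - 1) - int (p - 1)"
    using pq by (auto simp: of_nat_diff dvd_diff_commute simp del: power_Suc)
  then show "multiplicity 2 (p - 1) = multiplicity 2 (q - 1)"
    and "multiplicity 2 (p + 1) = multiplicity 2 (q + 1)"
    using multiplicity_two_cong[of "q - 1" "p - 1"] multiplicity_two_cong[of "p + 1" "q + 1"] pq
    by auto
qed

lemma odd_part_decomp:
  fixes x :: nat
  assumes "x > 0"
  obtains u :: int where "odd u" "int x = 2 ^ multiplicity 2 x * u"
proof -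
  obtain u where "x = 2 ^ multiplicity 2 x * u" "odd u"
    using multiplicity_decompose'[of x 2] assms by auto
  then show thesis using that[of "int u"] by (metis even_of_nat of_nat_mult of_nat_numeral of_nat_power)
qed

text \<open>The choices \<open>l = p\<close> and \<open>l = q\<close> swap the roles in
  \<open>two_primes_multiplicity\<close>. Conversely, with common valuations \<open>a\<close> and
  \<open>b\<close> the weight has valuation exactly \<open>a + b\<close>, and
  \<open>2 ^ (a + b)\<close> divides the gcd, so the quotient is odd.\<close>

lemma has_odd_quotient_two_primes:
  assumes pq: "prime p" "prime q" "odd p" "odd q" "p \<noteq> q"
  shows "has_odd_quotient (p * q) \<longleftrightarrow>
    multiplicity 2 (p - 1) = multiplicity 2 (q - 1) \<and> multiplicity 2 (p + 1) = multiplicity 2 (q + 1)"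
proof
  have gt: "p > 1" "q > 1" using pq by (auto intro: prime_gt_1_nat simp del: One_nat_def)
  then have N: "p * q > 1" by (metis less_1_mult)
  have pf: "prime_factors (p * q) = {p, q}"
    using pq gt by (simp add: prime_factors_product prime_prime_factors insert_commute)
  have sf: "squarefree (p * q)"
    using pq by (intro squarefree_mult_coprime squarefree_prime primes_coprime)
  have g: "g_num (p * q) = Gcd {int p * int q - 1, int p ^ 2 - 1, int q ^ 2 - 1}"
    using g_num_squarefree[OF N sf] pq(5) by (simp add: pf)
  have wp: "odd_weight (p * q) p = (int p + 1) * (int q - 1)"
    and wq: "odd_weight (p * q) q = (int q + 1) * (int p - 1)"
    using pq(5) by (auto simp: odd_weight_def pf insert_Diff_if)
  {
    assume "has_odd_quotient (p * q)"
    then obtain w where w: "odd w" and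
      "(int p + 1) * (int q - 1) = g_num (p * q) * w \<or> (int q + 1) * (int p - 1) = g_num (p * q) * w"
      unfolding has_odd_quotient_def pf using wp wq by auto
    moreover have "g_num (p * q) dvd int p * int q - 1" unfolding g by (rule Gcd_dvd) simp
    ultimately show "multiplicity 2 (p - 1) = multiplicity 2 (q - 1) \<and>
        multiplicity 2 (p + 1) = multiplicity 2 (q + 1)"
      using two_primes_multiplicity[of p q "g_num (p * q)" w]
        two_primes_multiplicity[of q p "g_num (p * q)" w] pq gt
      by (auto simp: mult.commute)
  }
  {
    assume eq: "multiplicity 2 (p - 1) = multiplicity 2 (q - 1) \<and>
        multiplicity 2 (p + 1) = multiplicity 2 (q + 1)"
    define a b where "a = multiplicity 2 (p - 1)" and "b = multiplicity 2 (p + 1)"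
    obtain u where u: "odd u" "int p - 1 = 2 ^ a * u"
      using odd_part_decomp[of "p - 1"] gt by (auto simp: a_def of_nat_diff)
    obtain u' where u': "odd u'" "int q - 1 = 2 ^ a * u'"
      using odd_part_decomp[of "q - 1"] gt eq by (auto simp: a_def of_nat_diff)
    obtain v where v: "odd v" "int p + 1 = 2 ^ b * v"
      using odd_part_decomp[of "p + 1"] by (auto simp: b_def add.commute)
    obtain v' where v': "odd v'" "int q + 1 = 2 ^ b * v'"
      using odd_part_decomp[of "q + 1"] eq by (auto simp: b_def add.commute)
    have "2 ^ (a + b) dvd int p - int q"
    proof -
      have ab: "2 ^ a dvd int p - 1" "2 ^ b dvd int p + 1" using u v by auto
      \<comment> \<open>\<open>p - 1\<close> and \<open>p + 1\<close> differ by 2, so one of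
        \<open>a\<close>, \<open>b\<close> is at most 1, and one power of 2 beyond each of
        \<open>a\<close> and \<open>b\<close> suffices. It comes from the even differences
        \<open>u - u'\<close> and \<open>v - v'\<close>.\<close>
      have "\<not> (a \<ge> 2 \<and> b \<ge> 2)"
      proof
        assume "a \<ge> 2 \<and> b \<ge> 2"
        then have "2 ^ 2 dvd int p - 1" "2 ^ 2 dvd int p + 1"
          using ab by (meson dvd_trans le_imp_power_dvd)+
        then have "2 ^ 2 dvd (int p + 1) - (int p - 1)"
          using dvd_diff[of "2 ^ 2" "int p + 1" "int p - 1"] by blast
        then show False by simp
      qed
      then have "a + b \<le> Suc a \<or> a + b \<le> Suc b" by auto
      moreover have "2 ^ Suc a dvd int p - int q"
      proof -
        have "int p - int q = 2 ^ a * (u - u')" using u(2) u'(2) by (simp add: algebra_simps)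
        then show ?thesis using u(1) u'(1) by (simp add: mult.commute[of 2])
      qed
      moreover have "2 ^ Suc b dvd int p - int q"
      proof -
        have "int p - int q = 2 ^ b * (v - v')" using v(2) v'(2) by (simp add: algebra_simps)
        then show ?thesis using v(1) v'(1) by (simp add: mult.commute[of 2])
      qed
      ultimately show ?thesis by (metis dvd_trans le_imp_power_dvd)
    qed
    moreover have W: "(int p + 1) * (int q - 1) = 2 ^ (a + b) * (v * u')"
      using u' v by (simp add: power_add)
    moreover have "int p * int q - 1 = (int p + 1) * (int q - 1) + (int p - int q)"
      by (simp add: algebra_simps)
    ultimately have "2 ^ (a + b) dvd int p * int q - 1" by (metis dvd_add dvd_triv_left)
    moreover have "int p ^ 2 - 1 = (int p - 1) * (int p + 1)" "int q ^ 2 - 1 = (int q - 1) * (int q + 1)"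
      by (auto simp: power2_eq_square algebra_simps)
    then have "2 ^ (a + b) dvd int p ^ 2 - 1" "2 ^ (a + b) dvd int q ^ 2 - 1"
      unfolding u u' v v' power_add by (auto intro!: mult_dvd_mono)
    ultimately have "2 ^ (a + b) dvd g_num (p * q)"
      unfolding g by (intro Gcd_greatest) auto
    then obtain k where k: "g_num (p * q) = 2 ^ (a + b) * k" by (elim dvdE)
    have mp: "multiplicity p (p * q) = 1"
      using squarefree_multiplicity[OF sf] by (simp add: pf)
    have "g_num (p * q) dvd odd_weight (p * q) p"
      by (rule g_num_dvd_odd_weight[OF N]) (simp_all add: pf mp)
    then obtain w where w: "odd_weight (p * q) p = g_num (p * q) * w" by (elim dvdE)
    then have "2 ^ (a + b) * (v * u') = 2 ^ (a + b) * (k * w)" using wp W k by simp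
    then have "v * u' = k * w" by simp
    then have "odd (k * w)" using v(1) u'(1) by (metis even_mult_iff)
    then have "odd w" by simp
    then show "has_odd_quotient (p * q)"
      by (intro has_odd_quotientI[OF _ _ _ w]) (simp_all add: pf mp)
  }
qed

section \<open>Comparison with the clauses of \<open>h_num\<close>\<close>

lemma h_num_two_primes:
  assumes "prime p" "prime q" "odd p" "odd q" "p \<noteq> q"
  shows "h_num (p * q) = (if has_odd_quotient (p * q) then 2 else 1)"
proof -
  have "\<not> prime (p * q)"
    using assms by (metis prime_product not_prime_1)
  moreover have "p * q \<noteq> 2 ^ r" if "odd r" for r
  proof
    assume "p * q = 2 ^ r"
    moreover have "r > 0" using that by (rule odd_pos)
    ultimately have "even (p * q)" by simp
    then show False using assms by simp
  qed
  moreover have "p * q \<noteq> 4 * s" for s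
    using assms by (metis even_mult_iff even_numeral)
  \<comment> \<open>The primes are determined only up to order, and the valuation conditions are
    symmetric.\<close>
  moreover have "(p' = p \<and> q' = q) \<or> (p' = q \<and> q' = p)"
    if "prime p'" "prime q'" "p * q = p' * q'" for p' q'
  proof -
    have "p' dvd p * q" using that(3) by simp
    then have "p' = p \<or> p' = q"
      using that(1) assms(1,2) by (metis prime_dvd_mult_iff primes_dvd_imp_eq)
    then show ?thesis
      using that(3) assms(1,2) by (auto simp: mult.commute)
  qed
  ultimately show ?thesis
    unfolding has_odd_quotient_two_primes[OF assms] h_num_def
    using assms by (smt (verit))
qed

lemma h_num_squarefree:
  assumes "N > 1" "squarefree N"
  shows "h_num N = (if has_odd_quotient N then 2 else 1)"
proof -
  have not4: "N \<noteq> 4 * s" for s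
    using assms(2) squarefreeD[of N 2] by auto
  \<comment> \<open>A squarefree power of 2 above 1 is 2 itself, so that clause falls under the
    prime one.\<close>
  have pow: "prime N" if "N = 2 ^ r" for r
    using assms that by (auto simp: squarefree_power_iff)
  consider "prime N" | "\<not> prime N" "even N" | "\<not> prime N" "odd N" by blast
  then show ?thesis
  proof cases
    case 1
    then show ?thesis by (simp add: h_num_def has_odd_quotient_prime)
  next
    case 2
    then show ?thesis
      using not_has_odd_quotient_even_squarefree[OF assms(2)] not4 pow
      by (auto simp: h_num_def)
  next
    case 3
    have prod: "(\<Prod>p\<in>prime_factors N. p) = N" by (rule squarefree_prod_prime_factors[OF assms(2)])
    have c0: "card (prime_factors N) \<noteq> 0" using prod assms(1) by auto
    have c1: "card (prime_factors N) \<noteq> 1"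
    proof
      assume "card (prime_factors N) = 1"
      then obtain p where "prime_factors N = {p}" by (auto simp: card_1_singleton_iff)
      then have "N = p" "p \<in> prime_factors N" using prod by auto
      then show False using 3(1) by auto
    qed
    show ?thesis
    proof (cases "card (prime_factors N) = 2")
      case True
      then obtain p q where pf: "prime_factors N = {p, q}" "p \<noteq> q" by (meson card_2_iff)
      then have "N = p * q" using prod by simp
      moreover have "prime p" "prime q" using pf by (auto intro: in_prime_factors_imp_prime)
      ultimately show ?thesis using h_num_two_primes[of p q] pf(2) 3(2) by simp
    next
      case False
      have "N \<noteq> p * q" if "prime p" "prime q" "p \<noteq> q" for p q
      proof
        assume "N = p * q"
        then have "prime_factors N = {p, q}"
          using that by (simp add: prime_factors_product prime_prime_factors insert_commute)
        then show False using False that(3) by simp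
      qed
      then show ?thesis
        using not_has_odd_quotient_three_primes[OF assms(2) 3(2)] False c0 c1 not4 pow 3(1)
        by (auto simp: h_num_def)
    qed
  qed
qed

lemma h_num_eq:
  assumes "N > 1"
  shows "h_num N = (if has_odd_quotient N then 2 else 1)"
proof (cases "squarefree N")
  case True
  then show ?thesis using h_num_squarefree assms by blast
next
  case False
  have not_prime: "\<not> prime N" using False squarefree_prime by blast
  have not_pq: "N \<noteq> p * q" if "prime p" "prime q" "p \<noteq> q" for p q
    using False that by (metis primes_coprime squarefree_mult_coprime squarefree_prime)
  \<comment> \<open>The clause \<open>4 * q\<close> always has the shape \<open>M * p ^ 2\<close>
    with \<open>p = 2\<close>, so it cannot occur at the remaining levels.\<close>
  have four: "sqfree_times_sq N q 2" if "prime q" "q mod 4 = 1" "N = 4 * q" for q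
  proof -
    have "odd q" using that(2) by presburger
    then show ?thesis using that
      by (auto simp: sqfree_times_sq_def squarefree_prime coprime_right_2_iff_odd)
  qed
  show ?thesis
  proof (cases "\<exists>M p. sqfree_times_sq N M p")
    case True
    then obtain M p where Mp: "sqfree_times_sq N M p" by blast
    \<comment> \<open>A power of 2 of the shape \<open>M * p ^ 2\<close> is 4, whose exponent is
      even.\<close>
    have "N \<noteq> 2 ^ r" if "odd r" for r
    proof
      assume r: "N = 2 ^ r"
      have "prime p" "p ^ 2 dvd N" using Mp by (auto simp: sqfree_times_sq_def)
      then have p2: "p = 2"
        using r by (metis dvd_trans dvd_triv_left power2_eq_square prime_dvd_power primes_dvd_imp_eq two_is_prime_nat)
      have "odd M" "N = M * 2 ^ 2" "M > 0"
        using Mp p2 assms by (auto simp: sqfree_times_sq_def coprime_right_2_iff_odd intro: Nat.gr0I)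
      then have "multiplicity 2 N = 2"
        using multiplicity_mult_prime_power[of 2 M 2 2] by simp
      then show False using r that by simp
    qed
    then show ?thesis
      unfolding has_odd_quotient_sqfree_times_sq[OF Mp] h_num_def
      using not_prime not_pq by (smt (verit))
  next
    case none: False
    then show ?thesis
      unfolding has_odd_quotient_other[OF assms False none] h_num_def
      using not_prime not_pq four by (smt (verit))
  qed
qed

theorem theorem3p17:
  fixes N :: nat
  assumes "N > 1"
  shows "GCD_div N (C_div N) = g_num N \<and> h_div N (C_div N) = h_num N"
  using GCD_div_C_div_eq_g_num[OF assms] h_div_eq[OF assms] h_num_eq[OF assms] by simp

end
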